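(* Let $\Omega=G/K$ be an irreducible bounded symmetric domain and $\mathcal A\in\mathrm{Gr}(p,T_o\Omega)$ such that $\Sigma(\mathcal A)=cH_0$ for some constant $c$. Then the function $\mathcal B\mapsto\|\Sigma(\mathcal B)\|^2_{\mathfrak g,\mathfrak l}$ on $\mathrm{Gr}(p,T_o\Omega)$ achieves its absolute minimum at $\mathcal A$.
   Context: Data: $\mathfrak g=\mathfrak l\oplus\mathfrak p$ Cartan decomposition of $\mathrm{Lie}(G)$, $H_0$ central in $\mathfrak l$ with $\mathrm{ad}(H_0)^2$ the Cartan involution and $\mathrm{ad}(H_0)|_{\mathfrak p}$ the complex structure at $o=eK$, $\mathfrak p^+\cong T^{1,0}_o\Omega$ the $\sqrt{-1}$-eigenspace of $\mathrm{ad}H_0$ in $\mathfrak p^{\mathbb C}$, with Hermitian form $(\alpha,\overline\beta)_{\mathcal K}$ ($\mathcal K$ the Killing form). $\mathrm{Gr}(p,T_o\Omega)$ is the Grassmannian of complex $p$-planes in $\mathfrak p^+$. For $\mathcal B$ with unitary basis $(e_i)$, $\Sigma(\mathcal B)=\sqrt{-1}\sum_i[e_i,\overline{e_i}]$. $\|\cdot\|_{\mathfrak g,\mathfrak l}$ is the norm on $\mathfrak l^{\mathbb C}$ from the Hermitian form $h_{\mathfrak g,\mathfrak l}(\lambda,\mu)=(\lambda,\overline\mu)_{\mathcal K}$. *)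

theory Defs
  imports "HOL-Analysis.Analysis"
begin

text \<open>Model: the complexified Lie algebra g^C is the complex vector space complex^'n with a
complex-bilinear bracket br. The real form g is the set of vectors fixed by componentwise
complex conjugation (coordinates w.r.t. a real basis of g), so br must commute with conjugation.\<close>

type_synonym 'n cvec = "complex ^ 'n"

definition conjv :: "'n::finite cvec \<Rightarrow> 'n cvec" where
  "conjv X = (\<chi> i. cnj (X $ i))"

definition realv :: "'n::finite cvec \<Rightarrow> bool" where
  "realv X \<longleftrightarrow> conjv X = X"

definition lie_algebra :: "('n::finite cvec \<Rightarrow> 'n cvec \<Rightarrow> 'n cvec) \<Rightarrow> bool" where
  "lie_algebra br \<longleftrightarrow>
     (\<forall>X. Vector_Spaces.linear (*s) (*s) (br X)) \<and>
     (\<forall>Y. Vector_Spaces.linear (*s) (*s) (\<lambda>X. br X Y)) \<and>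
     (\<forall>X. br X X = 0) \<and>
     (\<forall>X Y Z. br X (br Y Z) + br Y (br Z X) + br Z (br X Y) = 0)"

text \<open>Killing form: trace of ad X o ad Y on g^C (equal to the Killing form of g on real elements).\<close>
definition killing :: "('n::finite cvec \<Rightarrow> 'n cvec \<Rightarrow> 'n cvec) \<Rightarrow> 'n cvec \<Rightarrow> 'n cvec \<Rightarrow> complex" where
  "killing br X Y = (\<Sum>i\<in>UNIV. (br X (br Y (axis i 1))) $ i)"

definition real_subspace :: "'n::finite cvec set \<Rightarrow> bool" where
  "real_subspace S \<longleftrightarrow> 0 \<in> S \<and> (\<forall>x\<in>S. \<forall>y\<in>S. x + y \<in> S) \<and>
     (\<forall>r::real. \<forall>x\<in>S. complex_of_real r *s x \<in> S)"

definition real_form :: "'n::finite cvec set" where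
  "real_form = {X. realv X}"

definition real_ideal :: "('n::finite cvec \<Rightarrow> 'n cvec \<Rightarrow> 'n cvec) \<Rightarrow> 'n cvec set \<Rightarrow> bool" where
  "real_ideal br I \<longleftrightarrow> real_subspace I \<and> I \<subseteq> real_form \<and>
     (\<forall>X\<in>real_form. \<forall>Y\<in>I. br X Y \<in> I)"

text \<open>The real Lie algebra g is simple: non-abelian and without nontrivial proper ideals.\<close>
definition simple_real :: "('n::finite cvec \<Rightarrow> 'n cvec \<Rightarrow> 'n cvec) \<Rightarrow> bool" where
  "simple_real br \<longleftrightarrow> (\<exists>X\<in>real_form. \<exists>Y\<in>real_form. br X Y \<noteq> 0) \<and>
     (\<forall>I. real_ideal br I \<longrightarrow> I = {0} \<or> I = real_form)"

text \<open>Cartan decomposition g = l + p of a (noncompact) real Lie algebra.\<close>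
definition cartan_decomposition ::
  "('n::finite cvec \<Rightarrow> 'n cvec \<Rightarrow> 'n cvec) \<Rightarrow> 'n cvec set \<Rightarrow> 'n cvec set \<Rightarrow> bool" where
  "cartan_decomposition br l p \<longleftrightarrow>
     real_subspace l \<and> real_subspace p \<and> l \<subseteq> real_form \<and> p \<subseteq> real_form \<and>
     l \<inter> p = {0} \<and> (\<forall>X\<in>real_form. \<exists>a\<in>l. \<exists>b\<in>p. X = a + b) \<and>
     (\<forall>X\<in>l. \<forall>Y\<in>l. br X Y \<in> l) \<and> (\<forall>X\<in>l. \<forall>Y\<in>p. br X Y \<in> p) \<and>
     (\<forall>X\<in>p. \<forall>Y\<in>p. br X Y \<in> l) \<and>
     (\<forall>X\<in>l. X \<noteq> 0 \<longrightarrow> Re (killing br X X) < 0) \<and>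
     (\<forall>X\<in>p. X \<noteq> 0 \<longrightarrow> Re (killing br X X) > 0)"

text \<open>Data of an irreducible bounded symmetric domain Omega = G/K: g simple, Cartan
decomposition l + p with p nonzero (noncompact type), H0 central in l with ad(H0) restricted to p
a complex structure (ad(H0)^2 = -1 on p).\<close>
definition irreducible_bsd ::
  "('n::finite cvec \<Rightarrow> 'n cvec \<Rightarrow> 'n cvec) \<Rightarrow> 'n cvec set \<Rightarrow> 'n cvec set \<Rightarrow> 'n cvec \<Rightarrow> bool" where
  "irreducible_bsd br l p H0 \<longleftrightarrow>
     lie_algebra br \<and> (\<forall>X Y. br (conjv X) (conjv Y) = conjv (br X Y)) \<and>
     simple_real br \<and> cartan_decomposition br l p \<and> p \<noteq> {0} \<and>
     H0 \<in> l \<and> (\<forall>X\<in>l. br H0 X = 0) \<and> (\<forall>X\<in>p. br H0 (br H0 X) = - X)"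

definition complexify :: "'n::finite cvec set \<Rightarrow> 'n cvec set" where
  "complexify S = {a + \<i> *s b | a b. a \<in> S \<and> b \<in> S}"

text \<open>p^+ : the sqrt(-1)-eigenspace of ad H0 in p^C.\<close>
definition pplus :: "('n::finite cvec \<Rightarrow> 'n cvec \<Rightarrow> 'n cvec) \<Rightarrow> 'n cvec set \<Rightarrow> 'n cvec \<Rightarrow> 'n cvec set" where
  "pplus br p H0 = {X \<in> complexify p. br H0 X = \<i> *s X}"

text \<open>Hermitian form (alpha, conj beta)_K.\<close>
definition herm :: "('n::finite cvec \<Rightarrow> 'n cvec \<Rightarrow> 'n cvec) \<Rightarrow> 'n cvec \<Rightarrow> 'n cvec \<Rightarrow> complex" where
  "herm br X Y = killing br X (conjv Y)"

text \<open>Grassmannian of complex q-planes in P.\<close>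
definition grassmannian :: "nat \<Rightarrow> 'n::finite cvec set \<Rightarrow> 'n cvec set set" where
  "grassmannian q P = {B. vec.subspace B \<and> B \<subseteq> P \<and> vec.dim B = q}"

definition unitary_basis ::
  "('n::finite cvec \<Rightarrow> 'n cvec \<Rightarrow> 'n cvec) \<Rightarrow> nat \<Rightarrow> 'n cvec set \<Rightarrow> (nat \<Rightarrow> 'n cvec) \<Rightarrow> bool" where
  "unitary_basis br q B e \<longleftrightarrow> (\<forall>i<q. e i \<in> B) \<and>
     (\<forall>i<q. \<forall>j<q. herm br (e i) (e j) = (if i = j then 1 else 0)) \<and>
     vec.span (e ` {..<q}) = B"

text \<open>Sigma(B) = sqrt(-1) * sum_i [e_i, conj e_i] for a unitary basis (e_i) of B (independent
of the chosen unitary basis).\<close>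
definition Sigma :: "('n::finite cvec \<Rightarrow> 'n cvec \<Rightarrow> 'n cvec) \<Rightarrow> nat \<Rightarrow> 'n cvec set \<Rightarrow> 'n cvec" where
  "Sigma br q B = (let e = (SOME e. unitary_basis br q B e)
                   in \<i> *s (\<Sum>i<q. br (e i) (conjv (e i))))"

text \<open>Squared norm on l^C from the Hermitian form (lambda, conj mu)_K; since the Killing form is
negative definite on l, the positive definite form is its negative.\<close>
definition normsq_gl :: "('n::finite cvec \<Rightarrow> 'n cvec \<Rightarrow> 'n cvec) \<Rightarrow> 'n cvec \<Rightarrow> real" where
  "normsq_gl br X = Re (- killing br X (conjv X))"

end

theory Submission
  imports Defs
begin

text \<open>For a \<open>q\<close>-plane \<open>B \<subseteq> p\<^sup>+\<close> with unitary basis \<open>(e\<^sub>i)\<close>, each term \<open>\<i>[e\<^sub>i, conj e\<^sub>i]\<close>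
is twice a bracket of two elements of \<open>p\<close>, so \<open>Sigma(B) \<in> l\<close>. Invariance of the Killing form \<open>K\<close>
and \<open>ad H\<^sub>0 = \<i>\<close> on \<open>p\<^sup>+\<close> give \<open>K(Sigma(B), H\<^sub>0) = -q\<close>, the same for every \<open>B\<close>. So if
\<open>Sigma(A)\<close> is a multiple of \<open>H\<^sub>0\<close>, then \<open>Sigma(B) - Sigma(A) \<in> l\<close> is \<open>K\<close>-orthogonal to
\<open>Sigma(A)\<close>, and since \<open>-K\<close> is positive definite on \<open>l\<close>, Pythagoras gives
\<open>\<parallel>Sigma(A)\<parallel>\<^sup>2 \<le> \<parallel>Sigma(B)\<parallel>\<^sup>2\<close>.\<close>

lemma trace_comp_commute:
  fixes f g :: "complex^'n::finite \<Rightarrow> complex^'n"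
  assumes f: "Vector_Spaces.linear (*s) (*s) f" and g: "Vector_Spaces.linear (*s) (*s) g"
  shows "(\<Sum>i\<in>UNIV. f (g (axis i 1)) $ i) = (\<Sum>i\<in>UNIV. g (f (axis i 1)) $ i)"
proof -
  have expand: "u (v (axis i 1)) $ i = (\<Sum>j\<in>UNIV. v (axis i 1) $ j * u (axis j 1) $ i)"
    if u: "Vector_Spaces.linear (*s) (*s) u" for u v :: "complex^'n \<Rightarrow> complex^'n" and i
  proof -
    have "u (v (axis i 1)) = u (\<Sum>j\<in>UNIV. v (axis i 1) $ j *s axis j 1)"
      by (simp add: basis_expansion)
    also have "\<dots> = (\<Sum>j\<in>UNIV. v (axis i 1) $ j *s u (axis j 1))"
      by (simp add: vec.linear_sum[OF u] vec.linear_scale[OF u])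
    finally show ?thesis by (simp add: sum_component)
  qed
  have "(\<Sum>i\<in>UNIV. f (g (axis i 1)) $ i) =
      (\<Sum>i\<in>UNIV. \<Sum>j\<in>UNIV. g (axis i 1) $ j * f (axis j 1) $ i)"
    by (simp add: expand[OF f])
  also have "\<dots> = (\<Sum>j\<in>UNIV. \<Sum>i\<in>UNIV. f (axis j 1) $ i * g (axis i 1) $ j)"
    by (subst sum.swap) (simp add: mult.commute)
  also have "\<dots> = (\<Sum>j\<in>UNIV. g (f (axis j 1)) $ j)"
    by (simp add: expand[OF g])
  finally show ?thesis .
qed

lemma conjv_nth [simp]: "conjv X $ i = cnj (X $ i)" by (simp add: conjv_def)
lemma conjv_add [simp]: "conjv (X + Y) = conjv X + conjv Y" by (simp add: conjv_def vec_eq_iff)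
lemma conjv_diff [simp]: "conjv (X - Y) = conjv X - conjv Y" by (simp add: conjv_def vec_eq_iff)
lemma conjv_scale [simp]: "conjv (c *s X) = cnj c *s conjv X" by (simp add: conjv_def vec_eq_iff)
lemma conjv_conjv [simp]: "conjv (conjv X) = X" by (simp add: conjv_def vec_eq_iff)
lemma conjv_axis [simp]: "conjv (axis i 1) = axis i 1" by (simp add: conjv_def vec_eq_iff axis_def)

lemma conjv_real_form: "X \<in> real_form \<Longrightarrow> conjv X = X"
  by (simp add: real_form_def realv_def)

lemma real_subspace_sum: "real_subspace S \<Longrightarrow> (\<And>i. i \<in> I \<Longrightarrow> f i \<in> S) \<Longrightarrow> sum f I \<in> S"
  unfolding real_subspace_def by (induction I rule: infinite_finite_induct) auto

lemma real_subspace_diff: "real_subspace S \<Longrightarrow> x \<in> S \<Longrightarrow> y \<in> S \<Longrightarrow> x - y \<in> S"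
  unfolding real_subspace_def by (metis add_uminus_conv_diff of_real_1 of_real_minus vector_sneg_minus1)

lemma span_insert_scale_diff:
  fixes S :: "'n::finite cvec set"
  assumes s: "s \<in> vec.span S" and c: "c \<noteq> 0"
  shows "vec.span (insert (c *s (v - s)) S) = vec.span (insert v S)"
proof -
  have S_sub: "S \<subseteq> vec.span (insert x S)" for x
    using vec.span_superset vec.span_mono[of S "insert x S"] by blast
  have s_in: "s \<in> vec.span (insert x S)" for x
    using s vec.span_mono[of S "insert x S"] by blast
  have "c *s (v - s) \<in> vec.span (insert v S)"
    by (rule vec.span_scale, rule vec.span_diff) (simp_all add: vec.span_base s_in)
  moreover have "v \<in> vec.span (insert (c *s (v - s)) S)"
  proof -
    have "(1 / c) *s (c *s (v - s)) + s \<in> vec.span (insert (c *s (v - s)) S)"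
      by (rule vec.span_add, rule vec.span_scale) (simp_all add: vec.span_base s_in)
    then show ?thesis using c by simp
  qed
  ultimately show ?thesis
    unfolding vec.span_eq using S_sub by blast
qed

locale hermitian_form =
  fixes h :: "'n::finite cvec \<Rightarrow> 'n cvec \<Rightarrow> complex"
  assumes add_left: "h (x + y) z = h x z + h y z"
    and scale_left: "h (c *s x) z = c * h x z"
    and hermitian: "h y x = cnj (h x y)"
begin

lemma diff_left: "h (x - y) z = h x z - h y z"
  using add_left[of "x - y" y z] by simp

lemma sum_left: "h (sum f S) z = (\<Sum>a\<in>S. h (f a) z)"
  using scale_left[of 0 0 z] by (induction S rule: infinite_finite_induct) (auto simp: add_left)

lemma scale_right: "h x (c *s y) = cnj c * h x y"
  by (metis hermitian scale_left complex_cnj_mult complex_cnj_cnj)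

lemma self_real: "h x x = complex_of_real (Re (h x x))"
  using hermitian[of x x] by (simp add: complex_eq_iff)

lemma orthonormal_extend:
  fixes e :: "nat \<Rightarrow> 'n cvec"
  assumes W: "vec.subspace W" and pos: "\<And>w. w \<in> W \<Longrightarrow> w \<noteq> 0 \<Longrightarrow> Re (h w w) > 0"
    and eW: "\<forall>i<k. e i \<in> W" and orth: "\<forall>i<k. \<forall>j<k. h (e i) (e j) = (if i = j then 1 else 0)"
    and vW: "v \<in> W" and v: "v \<notin> vec.span (e ` {..<k})"
  obtains u where "u \<in> W" "h u u = 1" "\<And>i. i < k \<Longrightarrow> h u (e i) = 0"
    "vec.span (insert u (e ` {..<k})) = vec.span (insert v (e ` {..<k}))"
proof -
  define s where "s = (\<Sum>j<k. h v (e j) *s e j)"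
  define w where "w = v - s"
  have s_span: "s \<in> vec.span (e ` {..<k})"
    unfolding s_def by (intro vec.span_sum vec.span_scale vec.span_base) auto
  have wW: "w \<in> W"
    unfolding w_def s_def using vW eW
    by (intro vec.subspace_diff[OF W] vec.subspace_sum[OF W] vec.subspace_scale[OF W]) auto
  have w_ne: "w \<noteq> 0"
    using v s_span unfolding w_def by auto
  have w_orth: "h w (e i) = 0" if "i < k" for i
  proof -
    have "h s (e i) = (\<Sum>j<k. h v (e j) * h (e j) (e i))"
      unfolding s_def by (simp add: sum_left scale_left)
    also have "\<dots> = (\<Sum>j<k. if j = i then h v (e i) else 0)"
      using orth that by (intro sum.cong) auto
    also have "\<dots> = h v (e i)"
      using that by simp
    finally show ?thesis
      unfolding w_def by (simp add: diff_left)
  qed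
  define r where "r = sqrt (Re (h w w))"
  have r: "r > 0" "h w w = complex_of_real (r\<^sup>2)"
    using pos[OF wW w_ne] self_real[of w] by (auto simp: r_def)
  define u where "u = complex_of_real (1 / r) *s w"
  show ?thesis
  proof
    show "u \<in> W"
      unfolding u_def using wW by (rule vec.subspace_scale[OF W])
    show "h u u = 1"
      using r by (simp add: u_def scale_left scale_right power2_eq_square)
    show "h u (e i) = 0" if "i < k" for i
      using w_orth[OF that] by (simp add: u_def scale_left)
    show "vec.span (insert u (e ` {..<k})) = vec.span (insert v (e ` {..<k}))"
      unfolding u_def w_def using span_insert_scale_diff[OF s_span] r by simp
  qed
qed

lemma gram_schmidt:
  fixes v :: "nat \<Rightarrow> 'n cvec"
  assumes W: "vec.subspace W" and pos: "\<And>w. w \<in> W \<Longrightarrow> w \<noteq> 0 \<Longrightarrow> Re (h w w) > 0"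
    and "\<forall>i<k. v i \<in> W" "inj_on v {..<k}" "vec.independent (v ` {..<k})"
  shows "\<exists>e. (\<forall>i<k. e i \<in> W) \<and> (\<forall>i<k. \<forall>j<k. h (e i) (e j) = (if i = j then 1 else 0)) \<and>
      vec.span (e ` {..<k}) = vec.span (v ` {..<k})"
  using assms(3-5)
proof (induction k)
  case 0
  then show ?case by auto
next
  case (Suc k)
  have v_Suc: "v ` {..<Suc k} = insert (v k) (v ` {..<k})"
    by (simp add: lessThan_Suc)
  have "v k \<notin> v ` {..<k}"
    using Suc.prems(2) by (simp add: inj_on_image_mem_iff)
  then have indep: "vec.independent (v ` {..<k})" and v_new: "v k \<notin> vec.span (v ` {..<k})"
    using Suc.prems(3) unfolding v_Suc by (auto simp: vec.independent_insert)
  have "inj_on v {..<k}"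
    using Suc.prems(2) by (rule inj_on_subset) auto
  then obtain e where eW: "\<forall>i<k. e i \<in> W"
    and orth: "\<forall>i<k. \<forall>j<k. h (e i) (e j) = (if i = j then 1 else 0)"
    and span: "vec.span (e ` {..<k}) = vec.span (v ` {..<k})"
    using Suc.IH Suc.prems(1) indep by auto
  obtain u where uW: "u \<in> W" and uu: "h u u = 1" and ue: "\<And>i. i < k \<Longrightarrow> h u (e i) = 0"
    and span_u: "vec.span (insert u (e ` {..<k})) = vec.span (insert (v k) (e ` {..<k}))"
    using orthonormal_extend[OF W pos eW orth, of "v k"] Suc.prems(1) v_new span by auto
  have e_Suc: "(e(k := u)) ` {..<Suc k} = insert u (e ` {..<k})"
    by (auto simp: lessThan_Suc)
  have "h (e i) u = 0" if "i < k" for i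
    using ue[OF that] hermitian[of u "e i"] by simp
  then have "\<forall>i<Suc k. \<forall>j<Suc k. h ((e(k := u)) i) ((e(k := u)) j) = (if i = j then 1 else 0)"
    using orth uu ue by (auto simp: less_Suc_eq)
  moreover have "vec.span ((e(k := u)) ` {..<Suc k}) = vec.span (v ` {..<Suc k})"
    unfolding e_Suc v_Suc span_u using span by (simp add: vec.span_insert)
  ultimately show ?case
    using eW uW by (intro exI[of _ "e(k := u)"]) (auto simp: less_Suc_eq)
qed

lemma orthonormal_basis_exists:
  assumes W: "vec.subspace W" and pos: "\<And>w. w \<in> W \<Longrightarrow> w \<noteq> 0 \<Longrightarrow> Re (h w w) > 0"
    and dim: "vec.dim W = q"
  obtains e where "\<forall>i<q. e i \<in> W" "\<forall>i<q. \<forall>j<q. h (e i) (e j) = (if i = j then 1 else 0)"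
    "vec.span (e ` {..<q}) = W"
proof -
  obtain S where S: "S \<subseteq> W" "vec.independent S" "W \<subseteq> vec.span S" "card S = vec.dim W"
    by (rule vec.basis_exists)
  obtain v where "bij_betw v {..<q} S"
    using ex_bij_betw_nat_finite[OF vec.finiteI_independent[OF S(2)]] S(4) dim
    by (auto simp: atLeast0LessThan)
  then have v: "v ` {..<q} = S" "inj_on v {..<q}"
    by (auto simp: bij_betw_def)
  moreover have "\<forall>i<q. v i \<in> W"
    using v S(1) by auto
  ultimately obtain e where "\<forall>i<q. e i \<in> W" "\<forall>i<q. \<forall>j<q. h (e i) (e j) = (if i = j then 1 else 0)"
    "vec.span (e ` {..<q}) = vec.span S"
    using gram_schmidt[OF W pos, of q v] S(2) by auto
  with vec.span_subspace[OF S(1) S(3) W] that show ?thesis by simp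
qed

end

definition Sigma_basis ::
  "('n::finite cvec \<Rightarrow> 'n cvec \<Rightarrow> 'n cvec) \<Rightarrow> nat \<Rightarrow> (nat \<Rightarrow> 'n cvec) \<Rightarrow> 'n cvec" where
  "Sigma_basis br q e = \<i> *s (\<Sum>i<q. br (e i) (conjv (e i)))"

lemma Sigma_eq_Sigma_basis:
  assumes "\<exists>e. unitary_basis br q B e"
  obtains e where "unitary_basis br q B e" "Sigma br q B = Sigma_basis br q e"
  using someI_ex[OF assms] unfolding Sigma_def Sigma_basis_def Let_def by blast

lemma normsq_gl_real_form: "X \<in> real_form \<Longrightarrow> normsq_gl br X = - Re (killing br X X)"
  by (simp add: normsq_gl_def conjv_real_form)

locale complexified_lie_algebra =
  fixes br :: "'n::finite cvec \<Rightarrow> 'n cvec \<Rightarrow> 'n cvec"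
  assumes lie_algebra: "lie_algebra br"
    and bracket_conjv: "br (conjv X) (conjv Y) = conjv (br X Y)"
begin

lemma linear_bracket_right: "Vector_Spaces.linear (*s) (*s) (br X)"
  using lie_algebra by (simp add: lie_algebra_def)

lemma linear_bracket_left: "Vector_Spaces.linear (*s) (*s) (\<lambda>X. br X Y)"
  using lie_algebra by (simp add: lie_algebra_def)

lemma bracket_add_left: "br (X + Y) Z = br X Z + br Y Z"
  using vec.linear_add[OF linear_bracket_left] by simp

lemma bracket_scale_left: "br (c *s X) Z = c *s br X Z"
  using vec.linear_scale[OF linear_bracket_left] by simp

lemma bracket_diff_left: "br (X - Y) Z = br X Z - br Y Z"
  using vec.linear_diff[OF linear_bracket_left] by simp

lemma bracket_add_right: "br X (Y + Z) = br X Y + br X Z"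
  by (rule vec.linear_add[OF linear_bracket_right])

lemma bracket_scale_right: "br X (c *s Y) = c *s br X Y"
  by (rule vec.linear_scale[OF linear_bracket_right])

lemma bracket_diff_right: "br X (Y - Z) = br X Y - br X Z"
  by (rule vec.linear_diff[OF linear_bracket_right])

lemma bracket_self: "br X X = 0"
  using lie_algebra by (simp add: lie_algebra_def)

lemma bracket_antisym: "br Y X = - br X Y"
proof -
  have "br (X + Y) (X + Y) = br X Y + br Y X"
    by (subst bracket_add_left) (simp add: bracket_add_right bracket_self)
  then show ?thesis
    using bracket_self[of "X + Y"]
    by (metis add.commute eq_neg_iff_add_eq_0)
qed

lemma bracket_bracket_left: "br (br X Y) W = br X (br Y W) - br Y (br X W)"
proof -
  have "br W (br X Y) + br X (br Y W) + br Y (br W X) = 0"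
    using lie_algebra by (simp add: lie_algebra_def)
  then have "br W (br X Y) = - (br X (br Y W) + br Y (br W X))"
    by (metis eq_neg_iff_add_eq_0 add.assoc)
  moreover have "br Y (br W X) = - br Y (br X W)"
    using bracket_antisym[of X W] vec.linear_neg[OF linear_bracket_right] by simp
  ultimately show ?thesis
    using bracket_antisym[of "br X Y" W] by simp
qed

lemma killing_add_left: "killing br (X + Y) Z = killing br X Z + killing br Y Z"
  by (simp add: killing_def bracket_add_left sum.distrib)

lemma killing_scale_left: "killing br (c *s X) Z = c * killing br X Z"
  by (simp add: killing_def bracket_scale_left sum_distrib_left)

lemma killing_diff_left: "killing br (X - Y) Z = killing br X Z - killing br Y Z"
  by (simp add: killing_def bracket_diff_left sum_subtractf)

lemma killing_sum_left: "killing br (sum f S) Z = (\<Sum>a\<in>S. killing br (f a) Z)"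
  using killing_scale_left[of 0 0 Z]
  by (induction S rule: infinite_finite_induct) (auto simp: killing_add_left)

lemma killing_add_right: "killing br Z (X + Y) = killing br Z X + killing br Z Y"
  by (simp add: killing_def bracket_add_left bracket_add_right sum.distrib)

lemma killing_scale_right: "killing br Z (c *s X) = c * killing br Z X"
  by (simp add: killing_def bracket_scale_left bracket_scale_right sum_distrib_left)

lemma killing_diff_right: "killing br Z (X - Y) = killing br Z X - killing br Z Y"
  by (simp add: killing_def bracket_diff_left bracket_diff_right sum_subtractf)

lemma killing_commute: "killing br X Y = killing br Y X"
  unfolding killing_def by (rule trace_comp_commute[OF linear_bracket_right linear_bracket_right])

text \<open>By Jacobi, \<open>ad [X,Y] = ad X ad Y - ad Y ad X\<close>; invariance is then cyclicity of the trace.\<close>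
lemma killing_invariant: "killing br (br X Y) Z = killing br X (br Y Z)"
proof -
  have "Vector_Spaces.linear (*s) (*s) (br X \<circ> br Z)"
    by (rule Vector_Spaces.linear_compose[OF linear_bracket_right linear_bracket_right])
  from trace_comp_commute[OF linear_bracket_right this, of Y] show ?thesis
    unfolding killing_def by (simp add: bracket_bracket_left bracket_diff_right sum_subtractf)
qed

lemma killing_conjv: "killing br (conjv X) (conjv Y) = cnj (killing br X Y)"
proof -
  have "br (conjv X) (br (conjv Y) (axis i 1)) = conjv (br X (br Y (axis i 1)))" for i
    by (metis bracket_conjv conjv_axis)
  then show ?thesis
    unfolding killing_def by simp
qed

sublocale herm: hermitian_form "herm br"
proof
  show "herm br (X + Y) Z = herm br X Z + herm br Y Z" for X Y Z
    by (simp add: herm_def killing_add_left)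
  show "herm br (c *s X) Z = c * herm br X Z" for c X Z
    by (simp add: herm_def killing_scale_left)
  show "herm br Y X = cnj (herm br X Y)" for X Y
    unfolding herm_def using killing_conjv[of X "conjv Y"] killing_commute by simp
qed


lemma killing_zero_left: "killing br 0 X = 0"
  using killing_scale_left[of 0 0 X] by simp

lemma killing_pythagoras_le:
  assumes "killing br D X = 0" and "Re (killing br D D) \<le> 0"
  shows "Re (killing br (X + D) (X + D)) \<le> Re (killing br X X)"
  using assms killing_commute[of X D]
  by (simp add: killing_add_left killing_add_right)

lemma herm_self_complexify:
  assumes "a \<in> real_form" "b \<in> real_form"
  shows "herm br (a + \<i> *s b) (a + \<i> *s b) = killing br a a + killing br b b"
proof -
  have "herm br (a + \<i> *s b) (a + \<i> *s b) = killing br (a + \<i> *s b) (a + (- \<i>) *s b)"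
    unfolding herm_def using assms by (simp add: conjv_real_form)
  also have "\<dots> = killing br a a + killing br b b"
    by (simp add: killing_add_left killing_add_right killing_diff_right killing_scale_left
        killing_scale_right killing_commute[of b a] algebra_simps)
  finally show ?thesis .
qed

lemma herm_pos_complexify:
  assumes p: "p \<subseteq> real_form" and pos: "\<forall>X\<in>p. X \<noteq> 0 \<longrightarrow> Re (killing br X X) > 0"
    and w: "w \<in> complexify p" "w \<noteq> 0"
  shows "Re (herm br w w) > 0"
proof -
  obtain a b where ab: "w = a + \<i> *s b" "a \<in> p" "b \<in> p"
    using w(1) unfolding complexify_def by auto
  have nonneg: "Re (killing br X X) \<ge> 0" if "X \<in> p" for X
    using pos that by (cases "X = 0") (auto simp: killing_zero_left intro: less_imp_le)
  have "a \<noteq> 0 \<or> b \<noteq> 0"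
    using ab w(2) by auto
  then have "Re (killing br a a) > 0 \<or> Re (killing br b b) > 0"
    using pos ab by auto
  moreover have "herm br w w = killing br a a + killing br b b"
    using herm_self_complexify ab p by auto
  ultimately show ?thesis
    using nonneg[OF ab(2)] nonneg[OF ab(3)] ab(1) by auto
qed

lemma unitary_basis_exists:
  assumes p: "p \<subseteq> real_form" and pos: "\<forall>X\<in>p. X \<noteq> 0 \<longrightarrow> Re (killing br X X) > 0"
    and B: "B \<in> grassmannian q P" and P: "P \<subseteq> complexify p"
  shows "\<exists>e. unitary_basis br q B e"
proof -
  have "vec.subspace B" "vec.dim B = q" "B \<subseteq> complexify p"
    using B P unfolding grassmannian_def by auto
  then obtain e where "\<forall>i<q. e i \<in> B" "\<forall>i<q. \<forall>j<q. herm br (e i) (e j) = (if i = j then 1 else 0)"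
    "vec.span (e ` {..<q}) = B"
    using herm.orthonormal_basis_exists herm_pos_complexify[OF p pos] by blast
  then show ?thesis
    unfolding unitary_basis_def by blast
qed

lemma imag_bracket_conjv_mem:
  assumes p: "p \<subseteq> real_form" and pp: "\<forall>X\<in>p. \<forall>Y\<in>p. br X Y \<in> l" and l: "real_subspace l"
    and w: "w \<in> complexify p"
  shows "\<i> *s br w (conjv w) \<in> l"
proof -
  obtain a b where ab: "w = a + \<i> *s b" "a \<in> p" "b \<in> p"
    using w unfolding complexify_def by auto
  have "conjv a = a" "conjv b = b"
    using ab p by (auto intro: conjv_real_form)
  then have "conjv w = a - \<i> *s b"
    unfolding ab(1) by simp
  moreover have "\<i> *s br (a + \<i> *s b) (a - \<i> *s b) = complex_of_real 2 *s br a b"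
    by (simp add: bracket_add_left bracket_add_right bracket_diff_right bracket_scale_left
        bracket_scale_right bracket_self bracket_antisym[of a b] vec_eq_iff algebra_simps)
  ultimately have "\<i> *s br w (conjv w) = complex_of_real 2 *s br a b"
    using ab(1) by simp
  moreover have "br a b \<in> l"
    using pp ab by auto
  ultimately show ?thesis
    using l unfolding real_subspace_def by metis
qed

lemma Sigma_basis_mem:
  assumes p: "p \<subseteq> real_form" and pp: "\<forall>X\<in>p. \<forall>Y\<in>p. br X Y \<in> l" and l: "real_subspace l"
    and e: "\<forall>i<q. e i \<in> complexify p"
  shows "Sigma_basis br q e \<in> l"
  unfolding Sigma_basis_def vec.scale_sum_right
  using e by (intro real_subspace_sum[OF l] imag_bracket_conjv_mem[OF p pp l]) auto

lemma killing_Sigma_basis_H0: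
  assumes H0: "H0 \<in> real_form" and e: "unitary_basis br q B e" and B: "B \<subseteq> pplus br p H0"
  shows "killing br (Sigma_basis br q e) H0 = - of_nat q"
proof -
  have "killing br (br (e i) (conjv (e i))) H0 = \<i>" if "i < q" for i
  proof -
    have eigen: "br H0 (e i) = \<i> *s e i" and unit: "herm br (e i) (e i) = 1"
      using e B that unfolding unitary_basis_def pplus_def by auto
    have "br (conjv (e i)) H0 = - br H0 (conjv (e i))"
      by (rule bracket_antisym)
    also have "\<dots> = - conjv (br H0 (e i))"
      using bracket_conjv[of H0 "e i"] conjv_real_form[OF H0] by simp
    also have "\<dots> = \<i> *s conjv (e i)"
      using eigen by simp
    finally show ?thesis
      using unit by (simp add: killing_invariant killing_scale_right herm_def)
  qed
  then have "killing br (Sigma_basis br q e) H0 = \<i> * (of_nat q * \<i>)"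
    by (simp add: Sigma_basis_def killing_scale_left killing_sum_left)
  also have "\<dots> = of_nat q * (\<i> * \<i>)"
    by (rule mult.left_commute)
  finally show ?thesis
    by simp
qed

lemma Sigma_mem_and_killing_H0:
  assumes p: "p \<subseteq> real_form" and pos: "\<forall>X\<in>p. X \<noteq> 0 \<longrightarrow> Re (killing br X X) > 0"
    and pp: "\<forall>X\<in>p. \<forall>Y\<in>p. br X Y \<in> l" and l: "real_subspace l" and H0: "H0 \<in> real_form"
    and B: "B \<in> grassmannian q (pplus br p H0)"
  shows "Sigma br q B \<in> l" and "killing br (Sigma br q B) H0 = - of_nat q"
proof -
  have B_sub: "B \<subseteq> pplus br p H0" and "pplus br p H0 \<subseteq> complexify p"
    using B by (auto simp: grassmannian_def pplus_def)
  then obtain e where e: "unitary_basis br q B e" and Sigma: "Sigma br q B = Sigma_basis br q e"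
    using Sigma_eq_Sigma_basis unitary_basis_exists[OF p pos B] by blast
  have "\<forall>i<q. e i \<in> complexify p"
    using e B_sub by (auto simp: unitary_basis_def pplus_def)
  then show "Sigma br q B \<in> l"
    unfolding Sigma by (rule Sigma_basis_mem[OF p pp l])
  show "killing br (Sigma br q B) H0 = - of_nat q"
    unfolding Sigma by (rule killing_Sigma_basis_H0[OF H0 e B_sub])
qed

end

theorem lemma6:
  fixes br :: "'n::finite cvec \<Rightarrow> 'n cvec \<Rightarrow> 'n cvec"
    and l p :: "'n cvec set" and H0 :: "'n cvec" and q :: nat and A :: "'n cvec set"
  assumes "irreducible_bsd br l p H0"
    and "A \<in> grassmannian q (pplus br p H0)"
    and "\<exists>c::complex. Sigma br q A = c *s H0"
  shows "\<forall>B \<in> grassmannian q (pplus br p H0). normsq_gl br (Sigma br q A) \<le> normsq_gl br (Sigma br q B)"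
proof
  fix B assume B: "B \<in> grassmannian q (pplus br p H0)"
  interpret complexified_lie_algebra br
    using assms(1) unfolding irreducible_bsd_def by unfold_locales auto
  have l: "real_subspace l" "l \<subseteq> real_form" and p: "p \<subseteq> real_form"
    and pp: "\<forall>X\<in>p. \<forall>Y\<in>p. br X Y \<in> l"
    and l_neg: "\<forall>X\<in>l. X \<noteq> 0 \<longrightarrow> Re (killing br X X) < 0"
    and p_pos: "\<forall>X\<in>p. X \<noteq> 0 \<longrightarrow> Re (killing br X X) > 0"
    and H0: "H0 \<in> real_form"
    using assms(1) unfolding irreducible_bsd_def cartan_decomposition_def by auto
  note Sigma = Sigma_mem_and_killing_H0[OF p p_pos pp l(1) H0]
  obtain c where c: "Sigma br q A = c *s H0"
    using assms(3) by blast
  define D where "D = Sigma br q B - Sigma br q A"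
  have "D \<in> l"
    unfolding D_def using Sigma(1)[OF B] Sigma(1)[OF assms(2)] by (rule real_subspace_diff[OF l(1)])
  have "killing br D H0 = 0"
    unfolding D_def using Sigma(2)[OF B] Sigma(2)[OF assms(2)] by (simp add: killing_diff_left)
  then have "killing br D (Sigma br q A) = 0"
    unfolding c by (simp add: killing_scale_right)
  moreover have "Re (killing br D D) \<le> 0"
    using l_neg \<open>D \<in> l\<close> by (cases "D = 0") (auto simp: killing_zero_left intro: less_imp_le)
  ultimately have "Re (killing br (Sigma br q B) (Sigma br q B)) \<le> Re (killing br (Sigma br q A) (Sigma br q A))"
    using killing_pythagoras_le[of D "Sigma br q A"] unfolding D_def by simp
  moreover have "Sigma br q A \<in> real_form" "Sigma br q B \<in> real_form"
    using Sigma(1)[OF assms(2)] Sigma(1)[OF B] l(2) by auto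
  ultimately show "normsq_gl br (Sigma br q A) \<le> normsq_gl br (Sigma br q B)"
    by (simp add: normsq_gl_real_form)
qed

end
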